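(* Let $T>0$, $b\in\mathbb{R}$, and let $W^{\rm av}$, $W^{\rm ir}$, $W^{\rm st}$ be the anticipative version, the integral representation and the space-time transform of the Wiener bridge from $0$ to $b$ over the time-interval $[0,T]$, all constructed from the same standard Wiener process $W$. Then for all $t\in[0,T)$, $$\mathbb{E}\left((W_t-W_t^{\rm av})^2\right)=\mathbb{E}\left((W_t-W_t^{\rm st})^2\right)=\frac{t^2}{T}+b^2\frac{t^2}{T^2},$$ $$\mathbb{E}\left((W_t-W_t^{\rm ir})^2\right)=\sigma^2(t)+b^2\frac{t^2}{T^2},\qquad\text{where}\quad \sigma^2(t):=t\left(1+\frac{T-t}{T}\right)+2(T-t)\log\frac{T-t}{T}.$$ Moreover, $$\mathbb{E}\left(\int_0^T(W_t-W_t^{\rm av})^2\,\mathrm{d}t\right)=\mathbb{E}\left(\int_0^T(W_t-W_t^{\rm st})^2\,\mathrm{d}t\right)=\frac{T}{3}(T+b^2),$$ $$\mathbb{E}\left(\int_0^T(W_t-W_t^{\rm ir})^2\,\mathrm{d}t\right)=\frac{T}{3}\left(\frac{T}{2}+b^2\right).$$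
   Context: $(W_t)_{t\ge 0}$ is a standard one-dimensional Wiener process. For $T>0$ and $b\in\mathbb{R}$, the following three versions of the Wiener bridge from $0$ to $b$ over $[0,T]$ are considered, all built from this same $W$: Anticipative version: $W_t^{\rm av}=b\frac{t}{T}+\left(W_t-\frac{t}{T}W_T\right)$ for $0\le t\le T$. Integral representation: $W_t^{\rm ir}=b\frac{t}{T}+\int_0^t\frac{T-t}{T-s}\,\mathrm{d}W_s$ for $0\le t<T$, and $W_T^{\rm ir}=b$. Space-time transform: $W_t^{\rm st}=b\frac{t}{T}+\frac{T-t}{T}W_{\frac{tT}{T-t}}$ for $0\le t<T$, and $W_T^{\rm st}=b$. *)

theory Defs
  imports "HOL-Probability.Probability"
begin

locale wiener_process = prob_space M for M :: "'a measure" +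
  fixes W :: "real \<Rightarrow> 'a \<Rightarrow> real"
  assumes random_variable: "\<And>t. 0 \<le> t \<Longrightarrow> random_variable borel (W t)"
    and start: "AE \<omega> in M. W 0 \<omega> = 0"
    and indep_increments:
      "\<And>(n::nat) (\<tau> :: nat \<Rightarrow> real). 0 \<le> \<tau> 0 \<Longrightarrow> mono_on {..n} \<tau> \<Longrightarrow>
         indep_vars (\<lambda>_. borel) (\<lambda>i \<omega>. W (\<tau> (Suc i)) \<omega> - W (\<tau> i) \<omega>) {..<n}"
    and normal_increments:
      "\<And>s t. 0 \<le> s \<Longrightarrow> s < t \<Longrightarrow>
         distributed M lborel (\<lambda>\<omega>. W t \<omega> - W s \<omega>)
           (\<lambda>x. ennreal (normal_density 0 (sqrt (t - s)) x))"
    and continuous_paths: "AE \<omega> in M. continuous_on {0..} (\<lambda>t. W t \<omega>)"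

definition step_function :: "nat \<Rightarrow> (nat \<Rightarrow> real) \<Rightarrow> (nat \<Rightarrow> real) \<Rightarrow> real \<Rightarrow> real" where
  "step_function n c \<tau> s = (\<Sum>i<n. c i * indicator {\<tau> i<..\<tau> (Suc i)} s)"

definition step_integral ::
    "(real \<Rightarrow> 'a \<Rightarrow> real) \<Rightarrow> nat \<Rightarrow> (nat \<Rightarrow> real) \<Rightarrow> (nat \<Rightarrow> real) \<Rightarrow> 'a \<Rightarrow> real" where
  "step_integral W n c \<tau> \<omega> = (\<Sum>i<n. c i * (W (\<tau> (Suc i)) \<omega> - W (\<tau> i) \<omega>))"

text \<open>
  The stochastic integral of a deterministic integrand \<open>f\<close> over \<open>[0, t]\<close> with respect to \<open>W\<close>:
  the limit in \<open>L\<^sup>2(M)\<close> of the elementary integrals of step functions converging to \<open>f\<close> in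
  \<open>L\<^sup>2[0, t]\<close>. It is determined only up to a null set, hence a relation.
\<close>

definition has_wiener_integral ::
    "'a measure \<Rightarrow> (real \<Rightarrow> 'a \<Rightarrow> real) \<Rightarrow> real \<Rightarrow> (real \<Rightarrow> real) \<Rightarrow> ('a \<Rightarrow> real) \<Rightarrow> bool" where
  "has_wiener_integral M W t f X \<longleftrightarrow>
     set_borel_measurable lborel {0..t} f \<and> X \<in> borel_measurable M \<and>
     (\<exists>(n :: nat \<Rightarrow> nat) (c :: nat \<Rightarrow> nat \<Rightarrow> real) (\<tau> :: nat \<Rightarrow> nat \<Rightarrow> real).
        (\<forall>k. mono_on {..n k} (\<tau> k) \<and> 0 \<le> \<tau> k 0 \<and> \<tau> k (n k) \<le> t) \<and>
        (\<lambda>k. \<integral>\<^sup>+s\<in>{0..t}. ennreal ((f s - step_function (n k) (c k) (\<tau> k) s)\<^sup>2) \<partial>lborel)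
          \<longlonglongrightarrow> 0 \<and>
        (\<lambda>k. \<integral>\<^sup>+\<omega>. ennreal ((X \<omega> - step_integral W (n k) (c k) (\<tau> k) \<omega>)\<^sup>2) \<partial>M)
          \<longlonglongrightarrow> 0)"

definition bridge_av :: "(real \<Rightarrow> 'a \<Rightarrow> real) \<Rightarrow> real \<Rightarrow> real \<Rightarrow> real \<Rightarrow> 'a \<Rightarrow> real" where
  "bridge_av W T b t \<omega> = b * (t / T) + (W t \<omega> - (t / T) * W T \<omega>)"

text \<open>
  A version of the process \<open>\<integral>\<^sub>0\<^sup>t (T - t) / (T - s) dW\<^sub>s\<close>, \<open>0 \<le> t < T\<close>,
  with almost surely continuous paths, as usual for stochastic integrals.
\<close>

definition bridge_integral ::
    "'a measure \<Rightarrow> (real \<Rightarrow> 'a \<Rightarrow> real) \<Rightarrow> real \<Rightarrow> (real \<Rightarrow> 'a \<Rightarrow> real) \<Rightarrow> bool" where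
  "bridge_integral M W T J \<longleftrightarrow>
     (\<forall>t. 0 \<le> t \<and> t < T \<longrightarrow> has_wiener_integral M W t (\<lambda>s. (T - t) / (T - s)) (J t)) \<and>
     (AE \<omega> in M. continuous_on {0..<T} (\<lambda>t. J t \<omega>))"

text \<open>Here \<open>J\<close> stands for the process of stochastic integrals, see \<open>bridge_integral\<close>.\<close>

definition bridge_ir :: "(real \<Rightarrow> 'a \<Rightarrow> real) \<Rightarrow> real \<Rightarrow> real \<Rightarrow> real \<Rightarrow> 'a \<Rightarrow> real" where
  "bridge_ir J T b t \<omega> = (if t < T then b * (t / T) + J t \<omega> else b)"

definition bridge_st :: "(real \<Rightarrow> 'a \<Rightarrow> real) \<Rightarrow> real \<Rightarrow> real \<Rightarrow> real \<Rightarrow> 'a \<Rightarrow> real" where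
  "bridge_st W T b t \<omega> =
     (if t < T then b * (t / T) + ((T - t) / T) * W (t * T / (T - t)) \<omega> else b)"

definition sigma_sq :: "real \<Rightarrow> real \<Rightarrow> real" where
  "sigma_sq T t = t * (1 + (T - t) / T) + 2 * (T - t) * ln ((T - t) / T)"

text \<open>
  Expected time-integrated squared deviation of \<open>X\<close> from \<open>W\<close> over \<open>[0, T]\<close>. Paths are only
  almost surely continuous and \<open>M\<close> need not be complete, so the path integral may fail to be
  measurable on a null set; the nonnegative integral is insensitive to this, whereas the
  Bochner integral would default to 0.
\<close>

definition expected_int_sq_dev ::
    "'a measure \<Rightarrow> real \<Rightarrow> (real \<Rightarrow> 'a \<Rightarrow> real) \<Rightarrow> (real \<Rightarrow> 'a \<Rightarrow> real) \<Rightarrow> ennreal" where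
  "expected_int_sq_dev M T W X =
     (\<integral>\<^sup>+\<omega>. (\<integral>\<^sup>+t\<in>{0..T}. ennreal ((W t \<omega> - X t \<omega>)\<^sup>2) \<partial>lborel) \<partial>M)"

end

theory Submission
  imports Defs "HOL-Real_Asymp.Real_Asymp"
begin

text \<open>
  Up to the constant \<open>b * (t / T)\<close>, each of the three deviations \<open>W t - X t\<close> is a centred element of the
  Gaussian space spanned by the increments of \<open>W\<close>, so its second moment is the variance plus
  \<open>(b * (t / T))\<^sup>2\<close>, and the variance is the squared \<open>L\<^sup>2\<close> norm of the
  corresponding integrand.

  For the anticipative version the integrand is the constant \<open>t / T\<close> on \<open>[0, T]\<close>. For the space-time
  transform, with \<open>u = t * T / (T - t) \<ge> t\<close>, it is \<open>t / T\<close> on \<open>[0, t]\<close> and \<open>- (T - t) / T\<close> on \<open>[t, u]\<close>.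
  Both are step functions, and \<open>step_integral_second_moment\<close> gives the same value \<open>t\<^sup>2 / T\<close>.

  For the integral representation it is \<open>1 - (T - t) / (T - s)\<close> on \<open>[0, t]\<close>, which is not a step
  function. Its stochastic integral is known only as an \<open>L\<^sup>2\<close> limit of elementary integrals, so the
  isometry has to be carried to the limit: \<open>L2_limit_isometry\<close> does this simultaneously on both
  sides, and \<open>wiener_integral_deviation\<close> is the result. The elementary integral of \<open>g\<close> subtracted from
  \<open>W t\<close> is again an elementary integral, that of \<open>1 - g\<close> (\<open>step_integral_complement\<close>), so the isometry
  for step functions applies directly to the approximations of the deviation. The remaining integral
  over \<open>s\<close> is \<open>sigma_sq T t\<close>.

  The time-integrated statements follow by Tonelli and elementary calculus. Joint measurability in
  time and \<open>\<omega>\<close> is not given, but almost sure continuity of the paths provides a jointly measurable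
  modification, see \<open>nn_integral_swap_AE_continuous\<close>.
\<close>

section \<open>Moments of elementary stochastic integrals\<close>

lemma (in wiener_process) increment_moments:
  assumes "0 \<le> s" "s \<le> t"
  shows "has_bochner_integral M (\<lambda>\<omega>. W t \<omega> - W s \<omega>) 0"
    and "has_bochner_integral M (\<lambda>\<omega>. (W t \<omega> - W s \<omega>)\<^sup>2) (t - s)"
proof -
  have "has_bochner_integral M (\<lambda>\<omega>. W t \<omega> - W s \<omega>) 0 \<and>
        has_bochner_integral M (\<lambda>\<omega>. (W t \<omega> - W s \<omega>)\<^sup>2) (t - s)"
  proof (cases "s = t")
    case True
    then show ?thesis by (simp add: has_bochner_integral_zero)
  next
    case False
    then have st: "s < t" "0 < sqrt (t - s)" using assms by auto
    note D = normal_increments[OF assms(1) st(1)]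
    have "has_bochner_integral lborel (\<lambda>x. normal_density 0 (sqrt (t - s)) x * x) 0"
      using normal_moment_nz_1[OF st(2)] .
    moreover have "has_bochner_integral lborel (\<lambda>x. normal_density 0 (sqrt (t - s)) x * x\<^sup>2) (t - s)"
      using normal_moment_even[OF st(2), of 0 1] st(1)
      by (simp add: eval_nat_numeral diff_divide_distrib)
    ultimately show ?thesis
      unfolding has_bochner_integral_iff
      using distributed_integral[OF D, of "\<lambda>x. x"] distributed_integrable[OF D, of "\<lambda>x. x"]
        distributed_integral[OF D, of "\<lambda>x. x\<^sup>2"] distributed_integrable[OF D, of "\<lambda>x. x\<^sup>2"]
      by simp
  qed
  then show "has_bochner_integral M (\<lambda>\<omega>. W t \<omega> - W s \<omega>) 0"
    and "has_bochner_integral M (\<lambda>\<omega>. (W t \<omega> - W s \<omega>)\<^sup>2) (t - s)" by auto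
qed

text \<open>
  The intervals are added one at a time: the next increment is centred and independent of the sum of
  the earlier ones, so the mixed term of the square has expectation zero.
\<close>

lemma (in wiener_process) step_integral_moments:
  assumes "0 \<le> \<tau> 0" "mono_on {..n} \<tau>"
  shows "has_bochner_integral M (step_integral W n c \<tau>) 0"
    and "has_bochner_integral M (\<lambda>\<omega>. (step_integral W n c \<tau> \<omega>)\<^sup>2) (\<Sum>i<n. (c i)\<^sup>2 * (\<tau> (Suc i) - \<tau> i))"
proof -
  define D where "D i \<omega> = W (\<tau> (Suc i)) \<omega> - W (\<tau> i) \<omega>" for i \<omega>
  have \<tau>: "0 \<le> \<tau> i" "\<tau> i \<le> \<tau> (Suc i)" if "i < n" for i
  proof -
    have "\<tau> 0 \<le> \<tau> i" by (rule mono_onD[OF assms(2)]) (use that in auto)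
    then show "0 \<le> \<tau> i" using assms(1) by simp
    show "\<tau> i \<le> \<tau> (Suc i)" by (rule mono_onD[OF assms(2)]) (use that in auto)
  qed
  have D1: "has_bochner_integral M (\<lambda>\<omega>. c i * D i \<omega>) 0" if "i < n" for i
    using has_bochner_integral_mult_right[OF increment_moments(1)[OF \<tau>[OF that]], of "c i"]
    by (simp add: D_def)
  have D2: "has_bochner_integral M (\<lambda>\<omega>. (c i * D i \<omega>)\<^sup>2) ((c i)\<^sup>2 * (\<tau> (Suc i) - \<tau> i))" if "i < n" for i
    using has_bochner_integral_mult_right[OF increment_moments(2)[OF \<tau>[OF that]], of "(c i)\<^sup>2"]
    by (simp add: D_def power_mult_distrib)
  have "indep_vars (\<lambda>_. borel) D {..<n}"
    using indep_increments[OF assms] unfolding D_def .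
  then have indep: "indep_vars (\<lambda>_. borel) (\<lambda>i \<omega>. c i * D i \<omega>) {..<n}"
    by (rule indep_vars_compose2) simp
  have "has_bochner_integral M (\<lambda>\<omega>. \<Sum>i<m. c i * D i \<omega>) 0 \<and>
        has_bochner_integral M (\<lambda>\<omega>. (\<Sum>i<m. c i * D i \<omega>)\<^sup>2) (\<Sum>i<m. (c i)\<^sup>2 * (\<tau> (Suc i) - \<tau> i))"
    if "m \<le> n" for m
    using that
  proof (induction m)
    case 0
    then show ?case by (simp add: has_bochner_integral_zero)
  next
    case (Suc m)
    let ?S = "\<lambda>\<omega>. \<Sum>i<m. c i * D i \<omega>"
    from Suc have m: "m < n" and IH: "has_bochner_integral M ?S 0"
      "has_bochner_integral M (\<lambda>\<omega>. (?S \<omega>)\<^sup>2) (\<Sum>i<m. (c i)\<^sup>2 * (\<tau> (Suc i) - \<tau> i))" by auto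
    have "indep_vars (\<lambda>_. borel) (\<lambda>i \<omega>. c i * D i \<omega>) (insert m {..<m})"
      by (rule indep_vars_subset[OF indep]) (use m in auto)
    then have iv: "indep_var borel (\<lambda>\<omega>. c m * D m \<omega>) borel ?S"
      by (intro indep_vars_sum) auto
    have "has_bochner_integral M (\<lambda>\<omega>. (c m * D m \<omega>) * ?S \<omega>) 0"
      using indep_var_lebesgue_integral[OF iv] indep_var_integrable[OF iv] IH(1) D1[OF m]
      by (simp add: has_bochner_integral_iff)
    from has_bochner_integral_add[OF has_bochner_integral_add[OF IH(2) D2[OF m]]
        has_bochner_integral_mult_right[OF this, of 2]]
    have "has_bochner_integral M (\<lambda>\<omega>. (?S \<omega> + c m * D m \<omega>)\<^sup>2)
      (\<Sum>i<Suc m. (c i)\<^sup>2 * (\<tau> (Suc i) - \<tau> i))"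
      by (simp add: power2_sum algebra_simps)
    with has_bochner_integral_add[OF IH(1) D1[OF m]] show ?case by simp
  qed
  from this[OF order_refl] show "has_bochner_integral M (step_integral W n c \<tau>) 0"
    "has_bochner_integral M (\<lambda>\<omega>. (step_integral W n c \<tau> \<omega>)\<^sup>2) (\<Sum>i<n. (c i)\<^sup>2 * (\<tau> (Suc i) - \<tau> i))"
    by (simp_all add: step_integral_def[abs_def] D_def)
qed

text \<open>
  The constant \<open>a\<close> will be \<open>b * (t / T)\<close>, the drift of the bridge. Since elementary integrals are
  centred, it contributes only its own square.
\<close>

lemma (in wiener_process) step_integral_second_moment:
  assumes "0 \<le> \<tau> 0" "mono_on {..n} \<tau>"
  shows "has_bochner_integral M (\<lambda>\<omega>. (step_integral W n c \<tau> \<omega> - a)\<^sup>2)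
    ((\<Sum>i<n. (c i)\<^sup>2 * (\<tau> (Suc i) - \<tau> i)) + a\<^sup>2)"
proof -
  note m = step_integral_moments[OF assms, of c]
  have "has_bochner_integral M (\<lambda>\<omega>. a\<^sup>2) (a\<^sup>2)"
    using prob_space by (simp add: has_bochner_integral_iff)
  from has_bochner_integral_add[OF has_bochner_integral_diff[OF m(2)
      has_bochner_integral_mult_right[OF m(1), of "2 * a"]] this]
  show ?thesis by (simp add: power2_diff algebra_simps)
qed

section \<open>Step functions as elementary integrals\<close>

text \<open>
  Step functions are the elementary integrals of the process \<open>u \<mapsto> 1\<^bsub>s \<le> u\<^esub>\<close>. Algebraic identities
  between elementary integrals, valid for any integrator, therefore hold for step functions as well.
\<close>

lemma step_function_eq_step_integral:
  assumes "mono_on {..n} \<tau>"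
  shows "step_function n c \<tau> s = step_integral (\<lambda>u s. indicator {s..} u) n c \<tau> s"
  unfolding step_function_def step_integral_def
proof (rule sum.cong[OF refl])
  fix i assume "i \<in> {..<n}"
  then have "\<tau> i \<le> \<tau> (Suc i)" by (intro mono_onD[OF assms]) auto
  then show "c i * indicator {\<tau> i<..\<tau> (Suc i)} s = c i * (indicator {s..} (\<tau> (Suc i)) - indicator {s..} (\<tau> i))"
    by (auto simp: indicator_def)
qed

text \<open>
  The intervals of a partition are disjoint, so at most one summand is nonzero at each point and the
  mixed terms vanish.
\<close>

lemma step_function_square:
  assumes "mono_on {..n} \<tau>"
  shows "(step_function n c \<tau> s)\<^sup>2 = (\<Sum>i<n. (c i)\<^sup>2 * indicator {\<tau> i<..\<tau> (Suc i)} s)"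
proof (cases "\<exists>i<n. s \<in> {\<tau> i<..\<tau> (Suc i)}")
  case False
  then show ?thesis by (simp add: step_function_def)
next
  case True
  then obtain i where i: "i < n" "s \<in> {\<tau> i<..\<tau> (Suc i)}" by auto
  have out: "s \<notin> {\<tau> j<..\<tau> (Suc j)}" if "j < n" "j \<noteq> i" for j
  proof (cases "j < i")
    case True
    then have "\<tau> (Suc j) \<le> \<tau> i" using i by (intro mono_onD[OF assms]) auto
    then show ?thesis using i by auto
  next
    case False
    then have "\<tau> (Suc i) \<le> \<tau> j" using that by (intro mono_onD[OF assms]) auto
    then show ?thesis using i by auto
  qed
  have "(\<Sum>j<n. g j * indicator {\<tau> j<..\<tau> (Suc j)} s) = g i" for g :: "nat \<Rightarrow> real"
  proof -
    have "(\<Sum>j<n. g j * indicator {\<tau> j<..\<tau> (Suc j)} s) = (\<Sum>j<n. if j = i then g i else 0)"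
      using i(2) out by (intro sum.cong) auto
    then show ?thesis using i(1) by simp
  qed
  then show ?thesis by (simp add: step_function_def)
qed

lemma step_function_borel [measurable]: "step_function n c \<tau> \<in> borel_measurable borel"
  unfolding step_function_def[abs_def] by measurable

text \<open>
  The value is the variance in \<open>step_integral_moments\<close>: this is the isometry for step functions.
\<close>

lemma step_function_square_integral:
  assumes "0 \<le> \<tau> 0" "mono_on {..n} \<tau>" "\<tau> n \<le> t"
  shows "(\<integral>\<^sup>+s\<in>{0..t}. ennreal ((step_function n c \<tau> s)\<^sup>2) \<partial>lborel)
    = ennreal (\<Sum>i<n. (c i)\<^sup>2 * (\<tau> (Suc i) - \<tau> i))"
proof -
  have \<tau>: "0 \<le> \<tau> i" "\<tau> i \<le> \<tau> (Suc i)" "\<tau> (Suc i) \<le> t" if "i < n" for i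
  proof -
    have "\<tau> 0 \<le> \<tau> i" "\<tau> (Suc i) \<le> \<tau> n" by (rule mono_onD[OF assms(2)]; use that in auto)+
    then show "0 \<le> \<tau> i" "\<tau> (Suc i) \<le> t" using assms by simp_all
    show "\<tau> i \<le> \<tau> (Suc i)" by (rule mono_onD[OF assms(2)]) (use that in auto)
  qed
  have "(\<integral>\<^sup>+s\<in>{0..t}. ennreal ((step_function n c \<tau> s)\<^sup>2) \<partial>lborel)
    = (\<integral>\<^sup>+s. (\<Sum>i<n. ennreal ((c i)\<^sup>2) * indicator {\<tau> i<..\<tau> (Suc i)} s) \<partial>lborel)"
  proof (rule nn_integral_cong)
    fix s :: real
    show "ennreal ((step_function n c \<tau> s)\<^sup>2) * indicator {0..t} s
      = (\<Sum>i<n. ennreal ((c i)\<^sup>2) * indicator {\<tau> i<..\<tau> (Suc i)} s)"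
    proof (cases "s \<in> {0..t}")
      case True
      have "(\<Sum>i<n. ennreal ((c i)\<^sup>2) * indicator {\<tau> i<..\<tau> (Suc i)} s)
        = (\<Sum>i<n. ennreal ((c i)\<^sup>2 * indicator {\<tau> i<..\<tau> (Suc i)} s))"
        by (intro sum.cong) (auto split: split_indicator)
      also have "\<dots> = ennreal (\<Sum>i<n. (c i)\<^sup>2 * indicator {\<tau> i<..\<tau> (Suc i)} s)"
        by (intro sum_ennreal) auto
      finally show ?thesis using True step_function_square[OF assms(2)] by simp
    next
      case False
      then have "s \<notin> {\<tau> i<..\<tau> (Suc i)}" if "i < n" for i
        using \<tau>[OF that] by auto
      then show ?thesis using False by simp
    qed
  qed
  also have "\<dots> = (\<Sum>i<n. ennreal ((c i)\<^sup>2 * (\<tau> (Suc i) - \<tau> i)))"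
    using \<tau> by (subst nn_integral_sum) (auto simp: nn_integral_cmult ennreal_mult intro!: sum.cong)
  also have "\<dots> = ennreal (\<Sum>i<n. (c i)\<^sup>2 * (\<tau> (Suc i) - \<tau> i))"
    using \<tau> by (intro sum_ennreal) auto
  finally show ?thesis .
qed

text \<open>
  Coefficients and times of \<open>1 - step_function n c \<tau>\<close> on \<open>(0, t]\<close>. The partition of \<open>[\<tau> 0, \<tau> n]\<close> is
  completed to one of \<open>[0, t]\<close> by two further intervals, on which the step function is zero and the
  complement is one.
\<close>

definition complement_coeffs :: "nat \<Rightarrow> (nat \<Rightarrow> real) \<Rightarrow> nat \<Rightarrow> real" where
  "complement_coeffs n c = case_nat 1 (\<lambda>i. if i < n then 1 - c i else 1)"

definition complement_times :: "nat \<Rightarrow> (nat \<Rightarrow> real) \<Rightarrow> real \<Rightarrow> nat \<Rightarrow> real" where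
  "complement_times n \<tau> t = case_nat 0 (\<lambda>i. if i \<le> n then \<tau> i else t)"

lemma complement_times_ends:
  "complement_times n \<tau> t 0 = 0" "complement_times n \<tau> t (n + 2) = t"
  by (simp_all add: complement_times_def)

lemma mono_on_complement_times:
  assumes "0 \<le> \<tau> 0" "mono_on {..n} \<tau>" "\<tau> n \<le> t"
  shows "mono_on {..n + 2} (complement_times n \<tau> t)"
proof -
  have le: "0 \<le> \<tau> i" "\<tau> i \<le> t" if "i \<le> n" for i
  proof -
    have "\<tau> 0 \<le> \<tau> i" "\<tau> i \<le> \<tau> n" by (rule mono_onD[OF assms(2)]; use that in auto)+
    then show "0 \<le> \<tau> i" "\<tau> i \<le> t" using assms by simp_all
  qed
  from le[of 0] have "0 \<le> t" by simp
  with le show ?thesis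
    by (auto simp: complement_times_def mono_on_def split: nat.splits intro: mono_onD[OF assms(2)])
qed

text \<open>
  The constant integrand one on \<open>[0, t]\<close> integrates to \<open>V t - V 0\<close>, whatever the partition. For the
  Wiener process this represents the deviation of \<open>W\<close> from an elementary integral, and for the
  indicator process it says that the new step function is indeed \<open>1\<close> minus the old one.
\<close>

lemma step_integral_complement:
  "step_integral V (n + 2) (complement_coeffs n c) (complement_times n \<tau> t) x
    = V t x - V 0 x - step_integral V n c \<tau> x"
proof -
  have split: "(\<Sum>i<n + 2. g i) = g 0 + (\<Sum>i<n. g (Suc i)) + g (Suc n)" for g :: "nat \<Rightarrow> real"
    using sum.lessThan_Suc_shift[of g n] by simp
  have "step_integral V (n + 2) (complement_coeffs n c) (complement_times n \<tau> t) x
     = V (\<tau> 0) x - V 0 x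
     + (\<Sum>i<n. (1 - c i) * (V (\<tau> (Suc i)) x - V (\<tau> i) x)) + (V t x - V (\<tau> n) x)"
    unfolding step_integral_def complement_coeffs_def complement_times_def split by simp
  also have "(\<Sum>i<n. (1 - c i) * (V (\<tau> (Suc i)) x - V (\<tau> i) x))
     = (V (\<tau> n) x - V (\<tau> 0) x) - step_integral V n c \<tau> x"
    unfolding step_integral_def left_diff_distrib sum_subtractf
    by (simp add: sum_lessThan_telescope[where f = "\<lambda>i. V (\<tau> i) x"])
  finally show ?thesis by simp
qed


section \<open>Passing an isometry to the limit\<close>

text \<open>
  The inequality \<open>2 * z' * (z - z') \<le> e * z'\<^sup>2 + (z - z')\<^sup>2 / e\<close> replaces the triangle inequality for
  the \<open>L\<^sup>2\<close> norm; without square roots, it can be integrated term by term.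
\<close>

lemma L2_perturbation_le:
  fixes Z Z' :: "'a \<Rightarrow> real"
  assumes [measurable]: "Z \<in> borel_measurable M" "Z' \<in> borel_measurable M" and "e > 0"
  shows "(\<integral>\<^sup>+x. ennreal ((Z x)\<^sup>2) \<partial>M) \<le> ennreal (1 + e) * (\<integral>\<^sup>+x. ennreal ((Z' x)\<^sup>2) \<partial>M)
    + ennreal (1 + 1 / e) * (\<integral>\<^sup>+x. ennreal ((Z x - Z' x)\<^sup>2) \<partial>M)"
proof -
  have le: "z\<^sup>2 \<le> (1 + e) * z'\<^sup>2 + (1 + 1 / e) * (z - z')\<^sup>2" for z z' :: real
  proof -
    have "0 \<le> (e * z' - (z - z'))\<^sup>2 / e" using \<open>e > 0\<close> by simp
    also have "\<dots> = (1 + e) * z'\<^sup>2 + (1 + 1 / e) * (z - z')\<^sup>2 - z\<^sup>2"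
      using \<open>e > 0\<close> by (simp add: field_simps power2_eq_square)
    finally show ?thesis by simp
  qed
  have "(\<integral>\<^sup>+x. ennreal ((Z x)\<^sup>2) \<partial>M)
    \<le> (\<integral>\<^sup>+x. ennreal (1 + e) * ennreal ((Z' x)\<^sup>2) + ennreal (1 + 1 / e) * ennreal ((Z x - Z' x)\<^sup>2) \<partial>M)"
    using \<open>e > 0\<close> le
    by (intro nn_integral_mono) (simp flip: ennreal_mult ennreal_plus)
  also have "\<dots> = ennreal (1 + e) * (\<integral>\<^sup>+x. ennreal ((Z' x)\<^sup>2) \<partial>M)
    + ennreal (1 + 1 / e) * (\<integral>\<^sup>+x. ennreal ((Z x - Z' x)\<^sup>2) \<partial>M)"
    by (subst nn_integral_add) (simp_all add: nn_integral_cmult)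
  finally show ?thesis .
qed

text \<open>
  Passing from \<open>Z\<close> to \<open>Zs k\<close> and from \<open>Ys k\<close> to \<open>Y\<close> costs a factor \<open>1 + e\<close> each and errors that vanish
  as \<open>k\<close> grows; then \<open>e\<close> tends to zero.
\<close>

lemma L2_limit_isometry_le:
  fixes Z :: "'a \<Rightarrow> real" and Y :: "'b \<Rightarrow> real" and a b :: ennreal
  assumes [measurable]: "Z \<in> borel_measurable M" "\<And>k. Zs k \<in> borel_measurable M"
    "Y \<in> borel_measurable N" "\<And>k. Ys k \<in> borel_measurable N"
    and Z: "(\<lambda>k. \<integral>\<^sup>+x. ennreal ((Z x - Zs k x)\<^sup>2) \<partial>M) \<longlonglongrightarrow> 0"
    and Y: "(\<lambda>k. \<integral>\<^sup>+y. ennreal ((Y y - Ys k y)\<^sup>2) \<partial>N) \<longlonglongrightarrow> 0"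
    and eq: "\<And>k. (\<integral>\<^sup>+x. ennreal ((Zs k x)\<^sup>2) \<partial>M) + a = (\<integral>\<^sup>+y. ennreal ((Ys k y)\<^sup>2) \<partial>N) + b"
  shows "(\<integral>\<^sup>+x. ennreal ((Z x)\<^sup>2) \<partial>M) + a \<le> (\<integral>\<^sup>+y. ennreal ((Y y)\<^sup>2) \<partial>N) + b"
proof -
  let ?p = "(\<integral>\<^sup>+x. ennreal ((Z x)\<^sup>2) \<partial>M) + a" and ?q = "(\<integral>\<^sup>+y. ennreal ((Y y)\<^sup>2) \<partial>N) + b"
  let ?d = "\<lambda>k. \<integral>\<^sup>+x. ennreal ((Z x - Zs k x)\<^sup>2) \<partial>M"
  let ?d' = "\<lambda>k. \<integral>\<^sup>+y. ennreal ((Y y - Ys k y)\<^sup>2) \<partial>N"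
  have scale: "c \<le> ennreal (1 + e) * c" if "e > 0" for e and c :: ennreal
    using mult_right_mono[of 1 "ennreal (1 + e)" c] that by simp
  have bound: "?p \<le> ennreal ((1 + e)\<^sup>2) * ?q" if e: "e > 0" for e
  \<comment> \<open>Let \<open>k\<close> tend to infinity for fixed \<open>e\<close>.\<close>
  proof (rule LIMSEQ_le_const[where X = "\<lambda>k. ennreal ((1 + e)\<^sup>2) * ?q
      + ennreal (1 + e) * (ennreal (1 + 1 / e) * ?d' k) + ennreal (1 + 1 / e) * ?d k"])
    have "(\<lambda>k. ennreal ((1 + e)\<^sup>2) * ?q
      + ennreal (1 + e) * (ennreal (1 + 1 / e) * ?d' k) + ennreal (1 + 1 / e) * ?d k)
      \<longlonglongrightarrow> ennreal ((1 + e)\<^sup>2) * ?q + ennreal (1 + e) * (ennreal (1 + 1 / e) * 0) + ennreal (1 + 1 / e) * 0"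
      by (intro tendsto_add tendsto_const ennreal_tendsto_cmult Z Y) auto
    then show "(\<lambda>k. ennreal ((1 + e)\<^sup>2) * ?q
      + ennreal (1 + e) * (ennreal (1 + 1 / e) * ?d' k) + ennreal (1 + 1 / e) * ?d k)
      \<longlonglongrightarrow> ennreal ((1 + e)\<^sup>2) * ?q" by simp
    have "?p \<le> ennreal ((1 + e)\<^sup>2) * ?q
      + ennreal (1 + e) * (ennreal (1 + 1 / e) * ?d' k) + ennreal (1 + 1 / e) * ?d k" for k
    proof -
      have Ys_le: "(\<integral>\<^sup>+y. ennreal ((Ys k y)\<^sup>2) \<partial>N) + b \<le> ennreal (1 + e) * ?q + ennreal (1 + 1 / e) * ?d' k"
        using add_mono[OF L2_perturbation_le[of "Ys k" N Y e] scale[OF e, of b]] e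
        by (simp add: distrib_left ac_simps power2_commute)
      have "?p \<le> ennreal (1 + e) * ((\<integral>\<^sup>+x. ennreal ((Zs k x)\<^sup>2) \<partial>M) + a) + ennreal (1 + 1 / e) * ?d k"
        using add_mono[OF L2_perturbation_le[of Z M "Zs k" e] scale[OF e, of a]] e
        by (simp add: distrib_left ac_simps)
      also have "\<dots> = ennreal (1 + e) * ((\<integral>\<^sup>+y. ennreal ((Ys k y)\<^sup>2) \<partial>N) + b) + ennreal (1 + 1 / e) * ?d k"
        by (simp only: eq)
      also have "\<dots> \<le> ennreal (1 + e) * (ennreal (1 + e) * ?q + ennreal (1 + 1 / e) * ?d' k)
          + ennreal (1 + 1 / e) * ?d k"
        by (intro add_mono mult_left_mono order_refl Ys_le) simp
      also have "\<dots> = ennreal ((1 + e)\<^sup>2) * ?q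
        + ennreal (1 + e) * (ennreal (1 + 1 / e) * ?d' k) + ennreal (1 + 1 / e) * ?d k"
      proof -
        have "ennreal ((1 + e)\<^sup>2) = ennreal (1 + e) * ennreal (1 + e)"
          using e by (simp add: power2_eq_square ennreal_mult del: ennreal_plus)
        then show ?thesis by (simp only: distrib_left mult.assoc add.assoc)
      qed
      finally show ?thesis .
    qed
    then show "\<exists>K. \<forall>k\<ge>K. ?p \<le> ennreal ((1 + e)\<^sup>2) * ?q
      + ennreal (1 + e) * (ennreal (1 + 1 / e) * ?d' k) + ennreal (1 + 1 / e) * ?d k" by blast
  qed
  show ?thesis
  proof (cases "?q = \<top>")
    case False
    \<comment> \<open>Let \<open>e = 1 / (n + 1)\<close> tend to zero.\<close>
    show ?thesis
    proof (rule LIMSEQ_le_const[where X = "\<lambda>n. ennreal ((1 + inverse (real (Suc n)))\<^sup>2) * ?q"])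
      have "(\<lambda>n. (1 + inverse (real (Suc n)))\<^sup>2) \<longlonglongrightarrow> (1 + 0)\<^sup>2"
        by (intro tendsto_intros LIMSEQ_inverse_real_of_nat)
      then have "(\<lambda>n. ?q * ennreal ((1 + inverse (real (Suc n)))\<^sup>2)) \<longlonglongrightarrow> ?q * ennreal ((1 + 0)\<^sup>2)"
        using False by (intro ennreal_tendsto_cmult tendsto_ennrealI) (simp_all add: less_top)
      then show "(\<lambda>n. ennreal ((1 + inverse (real (Suc n)))\<^sup>2) * ?q) \<longlonglongrightarrow> ?q"
        by (simp add: mult.commute)
      show "\<exists>K. \<forall>n\<ge>K. ?p \<le> ennreal ((1 + inverse (real (Suc n)))\<^sup>2) * ?q"
        using bound[of "inverse (real (Suc n))" for n] by auto
    qed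
  qed (simp only: top_greatest)
qed

text \<open>
  The constants \<open>a\<close> and \<open>b\<close> make the hypotheses symmetric in the two sides, while allowing a second
  moment on one side to differ from that on the other by a fixed amount such as the squared drift.
\<close>

lemma L2_limit_isometry:
  fixes Z :: "'a \<Rightarrow> real" and Y :: "'b \<Rightarrow> real" and a b :: ennreal
  assumes "Z \<in> borel_measurable M" "\<And>k. Zs k \<in> borel_measurable M"
    "Y \<in> borel_measurable N" "\<And>k. Ys k \<in> borel_measurable N"
    and "(\<lambda>k. \<integral>\<^sup>+x. ennreal ((Z x - Zs k x)\<^sup>2) \<partial>M) \<longlonglongrightarrow> 0"
    and "(\<lambda>k. \<integral>\<^sup>+y. ennreal ((Y y - Ys k y)\<^sup>2) \<partial>N) \<longlonglongrightarrow> 0"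
    and eq: "\<And>k. (\<integral>\<^sup>+x. ennreal ((Zs k x)\<^sup>2) \<partial>M) + a = (\<integral>\<^sup>+y. ennreal ((Ys k y)\<^sup>2) \<partial>N) + b"
  shows "(\<integral>\<^sup>+x. ennreal ((Z x)\<^sup>2) \<partial>M) + a = (\<integral>\<^sup>+y. ennreal ((Y y)\<^sup>2) \<partial>N) + b"
  by (rule antisym; rule L2_limit_isometry_le[where Zs = Zs and Ys = Ys]
      L2_limit_isometry_le[where Zs = Ys and Ys = Zs]) (use assms eq[symmetric] in auto)

section \<open>Stochastic integrals of deterministic functions\<close>

text \<open>
  For the approximating step functions \<open>g\<close>, the deviation \<open>W t - W 0 - I g\<close> is the elementary integral of
  \<open>1 - g\<close>, so the isometry for step functions gives the claim with \<open>g\<close> in place of \<open>f\<close>. The differences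
  to the limits are \<open>X - I g\<close> and \<open>f - g\<close>, which tend to zero by the definition of the integral.
\<close>

lemma (in wiener_process) wiener_integral_deviation:
  assumes t: "0 \<le> t" and X: "has_wiener_integral M W t f X"
  shows "(\<integral>\<^sup>+\<omega>. ennreal ((W t \<omega> - X \<omega> - m)\<^sup>2) \<partial>M)
    = (\<integral>\<^sup>+s\<in>{0..t}. ennreal ((1 - f s)\<^sup>2) \<partial>lborel) + ennreal (m\<^sup>2)"
proof -
  from X obtain n c \<tau> where \<tau>: "\<And>k. mono_on {..n k} (\<tau> k)" "\<And>k. 0 \<le> \<tau> k 0" "\<And>k. \<tau> k (n k) \<le> t"
    and f: "(\<lambda>k. \<integral>\<^sup>+s\<in>{0..t}. ennreal ((f s - step_function (n k) (c k) (\<tau> k) s)\<^sup>2) \<partial>lborel) \<longlonglongrightarrow> 0"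
    and I: "(\<lambda>k. \<integral>\<^sup>+\<omega>. ennreal ((X \<omega> - step_integral W (n k) (c k) (\<tau> k) \<omega>)\<^sup>2) \<partial>M) \<longlonglongrightarrow> 0"
    unfolding has_wiener_integral_def by blast
  from X have [measurable]: "X \<in> borel_measurable M"
    and fm: "(\<lambda>s. indicator {0..t} s * f s) \<in> borel_measurable borel"
    by (auto simp: has_wiener_integral_def set_borel_measurable_def)
  have [measurable]: "W t \<in> borel_measurable M" "W 0 \<in> borel_measurable M"
    using random_variable t by auto
  let ?c = "\<lambda>k. complement_coeffs (n k) (c k)" and ?\<tau> = "\<lambda>k. complement_times (n k) (\<tau> k) t"
  let ?S = "\<lambda>k. step_function (n k + 2) (?c k) (?\<tau> k)"
  let ?Z = "\<lambda>\<omega>. W t \<omega> - W 0 \<omega> - X \<omega> - m"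
  let ?Zs = "\<lambda>k \<omega>. step_integral W (n k + 2) (?c k) (?\<tau> k) \<omega> - m"
  let ?Y = "\<lambda>s. indicator {0..t} s * (1 - f s)"
  let ?Ys = "\<lambda>k s. indicator {0..t} s * ?S k s"
  have \<tau>': "0 \<le> ?\<tau> k 0" "mono_on {..n k + 2} (?\<tau> k)" "?\<tau> k (n k + 2) \<le> t" for k
    using complement_times_ends[of "n k" "\<tau> k" t] mono_on_complement_times[OF \<tau>(2,1,3)] by simp_all
  \<comment> \<open>The point \<open>s = 0\<close> lies outside all the half-open intervals, so both step functions vanish there
    and the identity fails at this one point.\<close>
  have S: "?S k s = 1 - step_function (n k) (c k) (\<tau> k) s" if "s \<noteq> 0" "s \<in> {0..t}" for s k
    using that
    by (simp only: step_function_eq_step_integral[OF \<tau>(1)] step_function_eq_step_integral[OF \<tau>'(2)]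
        step_integral_complement) simp
  note second = step_integral_second_moment[OF \<tau>'(1,2)]
  have "(\<integral>\<^sup>+\<omega>. ennreal ((?Z \<omega>)\<^sup>2) \<partial>M) + 0 = (\<integral>\<^sup>+s. ennreal ((?Y s)\<^sup>2) \<partial>lborel) + ennreal (m\<^sup>2)"
  proof (rule L2_limit_isometry[where Zs = ?Zs and Ys = ?Ys])
    show "?Z \<in> borel_measurable M" by measurable
    show "?Zs k \<in> borel_measurable M" for k
      using step_integral_moments(1)[OF \<tau>'(1,2)] by (auto dest: borel_measurable_has_bochner_integral)
    have "(\<lambda>s. indicator {0..t} s - indicator {0..t} s * f s) \<in> borel_measurable borel"
      using fm by measurable
    then show "?Y \<in> borel_measurable lborel" by (simp add: right_diff_distrib)
    show "?Ys k \<in> borel_measurable lborel" for k by measurable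
    show "(\<lambda>k. \<integral>\<^sup>+\<omega>. ennreal ((?Z \<omega> - ?Zs k \<omega>)\<^sup>2) \<partial>M) \<longlonglongrightarrow> 0"
      using I by (simp only: step_integral_complement) (simp add: power2_commute)
    have "(\<integral>\<^sup>+s. ennreal ((?Y s - ?Ys k s)\<^sup>2) \<partial>lborel)
      = (\<integral>\<^sup>+s\<in>{0..t}. ennreal ((f s - step_function (n k) (c k) (\<tau> k) s)\<^sup>2) \<partial>lborel)" for k
    proof (rule nn_integral_cong_AE)
      show "AE s in lborel. ennreal ((?Y s - ?Ys k s)\<^sup>2)
        = ennreal ((f s - step_function (n k) (c k) (\<tau> k) s)\<^sup>2) * indicator {0..t} s"
        using AE_lborel_singleton[of "0::real"]
      proof eventually_elim
        case (elim s)
        then show ?case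
          by (cases "s \<in> {0..t}") (simp_all add: S power2_commute del: add_2_eq_Suc')
      qed
    qed
    then show "(\<lambda>k. \<integral>\<^sup>+s. ennreal ((?Y s - ?Ys k s)\<^sup>2) \<partial>lborel) \<longlonglongrightarrow> 0" using f by simp
    fix k
    let ?V = "\<Sum>i<n k + 2. (?c k i)\<^sup>2 * (?\<tau> k (Suc i) - ?\<tau> k i)"
    have V: "0 \<le> ?V"
      by (intro sum_nonneg mult_nonneg_nonneg) (auto intro: mono_onD[OF \<tau>'(2)])
    have "(\<integral>\<^sup>+\<omega>. ennreal ((?Zs k \<omega>)\<^sup>2) \<partial>M) = ennreal (?V + m\<^sup>2)"
      using nn_integral_eq_integral[of M "\<lambda>\<omega>. (?Zs k \<omega>)\<^sup>2"] second[of k "?c k" m]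
      by (simp add: has_bochner_integral_iff)
    moreover have "(\<integral>\<^sup>+s. ennreal ((?Ys k s)\<^sup>2) \<partial>lborel) = ennreal ?V"
      unfolding step_function_square_integral[OF \<tau>', symmetric]
      by (intro nn_integral_cong) (simp split: split_indicator)
    ultimately show "(\<integral>\<^sup>+\<omega>. ennreal ((?Zs k \<omega>)\<^sup>2) \<partial>M) + 0
      = (\<integral>\<^sup>+s. ennreal ((?Ys k s)\<^sup>2) \<partial>lborel) + ennreal (m\<^sup>2)"
      using V by (simp only: add_0_right ennreal_plus zero_le_power2)
  qed
  moreover have "(\<integral>\<^sup>+\<omega>. ennreal ((W t \<omega> - X \<omega> - m)\<^sup>2) \<partial>M) = (\<integral>\<^sup>+\<omega>. ennreal ((?Z \<omega>)\<^sup>2) \<partial>M)"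
    by (rule nn_integral_cong_AE) (use start in \<open>auto elim: eventually_mono\<close>)
  moreover have "(\<integral>\<^sup>+s. ennreal ((?Y s)\<^sup>2) \<partial>lborel) = (\<integral>\<^sup>+s\<in>{0..t}. ennreal ((1 - f s)\<^sup>2) \<partial>lborel)"
    by (intro nn_integral_cong) (simp split: split_indicator)
  ultimately show ?thesis by simp
qed

text \<open>
  Expanding the square, \<open>s + (T - t)\<^sup>2 / (T - s) + 2 * (T - t) * ln (T - s)\<close> is an antiderivative.
  Nonnegativity is a separate conclusion because \<open>ennreal\<close> truncates negative numbers.
\<close>

lemma wiener_kernel_square_integral:
  assumes "0 \<le> t" "t < T"
  shows "(\<integral>\<^sup>+s\<in>{0..t}. ennreal ((1 - (T - t) / (T - s))\<^sup>2) \<partial>lborel) = ennreal (sigma_sq T t)"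
    and "0 \<le> sigma_sq T t"
proof -
  let ?F = "\<lambda>s. s + (T - t)\<^sup>2 / (T - s) + 2 * (T - t) * ln (T - s)"
  have deriv: "(?F has_real_derivative (1 - (T - t) / (T - s))\<^sup>2) (at s)" if "s \<le> t" for s
  proof -
    have "T - s > 0" using assms that by auto
    then have "(?F has_real_derivative 1 + (T - t)\<^sup>2 / (T - s)\<^sup>2 - 2 * (T - t) / (T - s)) (at s)"
      by (auto intro!: derivative_eq_intros simp: power2_eq_square)
    then show ?thesis by (simp add: power2_diff power_divide)
  qed
  have F: "?F t - ?F 0 = sigma_sq T t"
    using assms by (simp add: sigma_sq_def ln_div field_simps power2_eq_square)
  show "(\<integral>\<^sup>+s\<in>{0..t}. ennreal ((1 - (T - t) / (T - s))\<^sup>2) \<partial>lborel) = ennreal (sigma_sq T t)"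
    unfolding F[symmetric]
    by (rule nn_integral_FTC_Icc)
      (use assms deriv in \<open>auto intro: has_field_derivative_at_within\<close>)
  have "?F 0 \<le> ?F t"
    by (rule DERIV_nonneg_imp_nondecreasing[OF assms(1)]) (use deriv zero_le_power2 in blast)
  with F show "0 \<le> sigma_sq T t" by simp
qed

section \<open>Integration over time\<close>

text \<open>
  Outside a null set the paths are continuous, so there \<open>D t\<close> is the limit of the values of \<open>D\<close> at the
  grid points \<open>\<lfloor>n * t\<rfloor> / n\<close>. These approximations take countably many random variables, each measurable,
  and are thus jointly measurable; hence so is \<open>D\<close> after it is set to zero on the null set, and Tonelli
  applies. Rounding down keeps the grid points inside \<open>[0, T)\<close>. The end points of the time interval form
  a null set.
\<close>

lemma nn_integral_swap_AE_continuous: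
  fixes D :: "real \<Rightarrow> 'a \<Rightarrow> real"
  assumes "sigma_finite_measure M"
    and D: "\<And>t. t \<in> {0..<T} \<Longrightarrow> D t \<in> borel_measurable M"
    and "AE \<omega> in M. continuous_on {0..<T} (\<lambda>t. D t \<omega>)"
  shows "(\<integral>\<^sup>+\<omega>. (\<integral>\<^sup>+t\<in>{0..T}. ennreal ((D t \<omega>)\<^sup>2) \<partial>lborel) \<partial>M)
    = (\<integral>\<^sup>+t\<in>{0<..<T}. (\<integral>\<^sup>+\<omega>. ennreal ((D t \<omega>)\<^sup>2) \<partial>M) \<partial>lborel)"
proof -
  interpret M: sigma_finite_measure M by fact
  interpret pair_sigma_finite lborel M ..
  from assms(3) obtain N where N: "N \<in> null_sets M"
    and cont: "\<And>\<omega>. \<omega> \<in> space M - N \<Longrightarrow> continuous_on {0..<T} (\<lambda>t. D t \<omega>)"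
    by (auto elim!: AE_E3)
  then have [measurable]: "N \<in> sets M" by auto
  define G where "G = (\<lambda>(t, \<omega>). if t \<in> {0<..<T} \<and> \<omega> \<notin> N then D t \<omega> else 0)"
  define H where "H n i \<omega> = (if i / real (Suc n) \<in> {0..<T} then D (i / real (Suc n)) \<omega> else 0)"
    for n i \<omega>
  define g where "g n = (\<lambda>(t, \<omega>). if t \<in> {0<..<T} \<and> \<omega> \<notin> N
    then H n (real_of_int \<lfloor>real (Suc n) * t\<rfloor>) \<omega> else 0)" for n
  have [measurable]: "H n i \<in> borel_measurable M" for n i
    unfolding H_def using D[of "i / real (Suc n)"]
    by (cases "i / real (Suc n) \<in> {0..<T}") (simp_all only: if_True if_False measurable_const UNIV_I space_borel)
  have "(\<lambda>x. H n (real_of_int \<lfloor>real (Suc n) * fst x\<rfloor>) (snd x)) \<in> borel_measurable (lborel \<Otimes>\<^sub>M M)" for n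
    by (rule measurable_compose_countable[where f = "\<lambda>i x. H n (real_of_int i) (snd x)"]) measurable
  then have [measurable]: "g n \<in> borel_measurable (lborel \<Otimes>\<^sub>M M)" for n
    unfolding g_def case_prod_beta by measurable
  have "G \<in> borel_measurable (lborel \<Otimes>\<^sub>M M)"
  proof (rule borel_measurable_LIMSEQ_real[where u = g])
    fix x :: "real \<times> 'a" assume "x \<in> space (lborel \<Otimes>\<^sub>M M)"
    then obtain t \<omega> where x: "x = (t, \<omega>)" "\<omega> \<in> space M" by (auto simp: space_pair_measure)
    show "(\<lambda>n. g n x) \<longlonglongrightarrow> G x"
    proof (cases "t \<in> {0<..<T} \<and> \<omega> \<notin> N")
      case True
      let ?a = "\<lambda>n. real_of_int \<lfloor>real (Suc n) * t\<rfloor> / real (Suc n)"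
      have upper: "?a n \<le> t" for n
        by (simp add: divide_le_eq mult.commute)
      have lower: "t - inverse (real (Suc n)) \<le> ?a n" for n
      proof -
        have "real (Suc n) * t - 1 \<le> real_of_int \<lfloor>real (Suc n) * t\<rfloor>" by linarith
        moreover have "(t - inverse (real (Suc n))) * real (Suc n) = real (Suc n) * t - 1"
          by (simp add: field_simps)
        ultimately show ?thesis by (simp add: pos_le_divide_eq del: of_nat_Suc)
      qed
      have nonneg: "0 \<le> ?a n" for n using True by simp
      have "(\<lambda>n. t - inverse (real (Suc n))) \<longlonglongrightarrow> t - 0"
        by (intro tendsto_intros LIMSEQ_inverse_real_of_nat)
      then have "?a \<longlonglongrightarrow> t"
        by (intro tendsto_sandwich[of "\<lambda>n. t - inverse (real (Suc n))" ?a _ "\<lambda>n. t"])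
          (use upper lower in auto)
      moreover have in_range: "?a n \<in> {0..<T}" for n using upper[of n] nonneg[of n] True by auto
      ultimately have "(\<lambda>n. D (?a n) \<omega>) \<longlonglongrightarrow> D t \<omega>"
        using continuous_on_tendsto_compose[OF cont[of \<omega>], of ?a t sequentially] True x by simp
      moreover have "g n x = D (?a n) \<omega>" for n
        unfolding g_def H_def using True x in_range[of n] by simp
      ultimately show ?thesis using True x by (simp add: G_def)
    next
      case False
      then show ?thesis using x by (auto simp: g_def G_def)
    qed
  qed simp
  then have [measurable]: "(\<lambda>(t, \<omega>). ennreal ((G (t, \<omega>))\<^sup>2)) \<in> borel_measurable (lborel \<Otimes>\<^sub>M M)"
    by measurable
  have "(\<integral>\<^sup>+\<omega>. (\<integral>\<^sup>+t\<in>{0..T}. ennreal ((D t \<omega>)\<^sup>2) \<partial>lborel) \<partial>M)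
    = (\<integral>\<^sup>+\<omega>. (\<integral>\<^sup>+t. ennreal ((G (t, \<omega>))\<^sup>2) \<partial>lborel) \<partial>M)"
    using AE_not_in[OF N]
  proof (intro nn_integral_cong_AE, eventually_elim)
    case (elim \<omega>)
    show ?case
      using AE_lborel_singleton[of "0::real"] AE_lborel_singleton[of T]
    proof (intro nn_integral_cong_AE, eventually_elim)
      case (elim t)
      then show ?case using \<open>\<omega> \<notin> N\<close> by (auto simp: G_def split: split_indicator)
    qed
  qed
  also have "\<dots> = (\<integral>\<^sup>+t. (\<integral>\<^sup>+\<omega>. ennreal ((G (t, \<omega>))\<^sup>2) \<partial>M) \<partial>lborel)"
    by (rule Fubini') measurable
  also have "\<dots> = (\<integral>\<^sup>+t\<in>{0<..<T}. (\<integral>\<^sup>+\<omega>. ennreal ((D t \<omega>)\<^sup>2) \<partial>M) \<partial>lborel)"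
  proof (rule nn_integral_cong)
    fix t :: real
    show "(\<integral>\<^sup>+\<omega>. ennreal ((G (t, \<omega>))\<^sup>2) \<partial>M)
      = (\<integral>\<^sup>+\<omega>. ennreal ((D t \<omega>)\<^sup>2) \<partial>M) * indicator {0<..<T} t"
    proof (cases "t \<in> {0<..<T}")
      case True
      have "(\<integral>\<^sup>+\<omega>. ennreal ((G (t, \<omega>))\<^sup>2) \<partial>M) = (\<integral>\<^sup>+\<omega>. ennreal ((D t \<omega>)\<^sup>2) \<partial>M)"
        using AE_not_in[OF N]
        by (intro nn_integral_cong_AE) (auto elim!: eventually_mono simp: G_def True[simplified])
      then show ?thesis using True by simp
    qed (auto simp: G_def)
  qed
  finally show ?thesis .
qed

text \<open>
  Differentiability at the end points is not assumed: the antiderivative of \<open>sigma_sq T\<close> contains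
  \<open>ln ((T - t) / T)\<close>, which is singular at \<open>t = T\<close>.
\<close>

lemma nn_integral_FTC_Ioo:
  fixes f F :: "real \<Rightarrow> real"
  assumes [measurable]: "f \<in> borel_measurable borel" and "a \<le> b" "continuous_on {a..b} F"
    and "\<And>x. x \<in> {a<..<b} \<Longrightarrow> (F has_real_derivative f x) (at x)"
    and nonneg: "\<And>x. x \<in> {a<..<b} \<Longrightarrow> 0 \<le> f x"
  shows "(\<integral>\<^sup>+x\<in>{a<..<b}. ennreal (f x) \<partial>lborel) = ennreal (F b - F a)"
proof -
  have "(f has_integral (F b - F a)) {a<..<b}"
    using fundamental_theorem_of_calculus_interior[OF assms(2,3), of f] assms(4)
    by (simp add: has_integral_Icc_iff_Ioo has_real_derivative_iff_has_vector_derivative)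
  then have "((\<lambda>x. if x \<in> {a<..<b} then f x else 0) has_integral (F b - F a)) UNIV"
    by (simp only: has_integral_restrict_UNIV)
  from nn_integral_has_integral_lborel[OF _ _ this] nonneg
  have "(\<integral>\<^sup>+x. ennreal (if x \<in> {a<..<b} then f x else 0) \<partial>lborel) = ennreal (F b - F a)" by simp
  moreover have "(\<integral>\<^sup>+x\<in>{a<..<b}. ennreal (f x) \<partial>lborel)
      = (\<integral>\<^sup>+x. ennreal (if x \<in> {a<..<b} then f x else 0) \<partial>lborel)"
    by (intro nn_integral_cong) (simp split: split_indicator)
  ultimately show ?thesis by simp
qed

lemma nn_integral_scaled_square:
  fixes A :: real
  assumes "0 \<le> A" "0 \<le> T"
  shows "(\<integral>\<^sup>+t\<in>{0<..<T}. ennreal (A * t\<^sup>2) \<partial>lborel) = ennreal (A * T ^ 3 / 3)"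
proof -
  have "(\<integral>\<^sup>+t\<in>{0<..<T}. ennreal (A * t\<^sup>2) \<partial>lborel) = ennreal (A * T ^ 3 / 3 - A * 0 ^ 3 / 3)"
    by (rule nn_integral_FTC_Ioo) (use assms in \<open>auto intro!: continuous_intros derivative_eq_intros\<close>)
  then show ?thesis by simp
qed

text \<open>
  At \<open>0\<close> the value is \<open>0\<close>, which is also the limit.
\<close>

lemma continuous_on_square_ln: "continuous_on {0..} (\<lambda>x::real. x\<^sup>2 * ln x)"
  unfolding continuous_on_def
proof
  fix x :: real assume "x \<in> {0..}"
  show "((\<lambda>x. x\<^sup>2 * ln x) \<longlongrightarrow> x\<^sup>2 * ln x) (at x within {0..})"
  proof (cases "x = 0")
    case True
    have "((\<lambda>x::real. x\<^sup>2 * ln x) \<longlongrightarrow> 0) (at_right 0)" by real_asymp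
    then show ?thesis using True by (simp add: at_within_Ici_at_right)
  next
    case False
    then show ?thesis by (auto intro!: tendsto_intros)
  qed
qed

text \<open>
  With \<open>u = (T - t) / T\<close>, the logarithmic term \<open>2 * T * u * ln u\<close> has the antiderivative
  \<open>- T\<^sup>2 * u\<^sup>2 * ln u + T\<^sup>2 * u\<^sup>2 / 2\<close> in \<open>t\<close>.
\<close>

lemma nn_integral_sigma_sq:
  assumes T: "0 < T"
  shows "(\<integral>\<^sup>+t\<in>{0<..<T}. ennreal (sigma_sq T t + b\<^sup>2 * (t\<^sup>2 / T\<^sup>2)) \<partial>lborel)
    = ennreal (T / 3 * (T / 2 + b\<^sup>2))"
proof -
  let ?u = "\<lambda>t. (T - t) / T"
  let ?F = "\<lambda>t. t\<^sup>2 - t ^ 3 / (3 * T) - T\<^sup>2 * ((?u t)\<^sup>2 * ln (?u t)) + (T - t)\<^sup>2 / 2 + b\<^sup>2 * t ^ 3 / (3 * T\<^sup>2)"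
  have "(\<integral>\<^sup>+t\<in>{0<..<T}. ennreal (sigma_sq T t + b\<^sup>2 * (t\<^sup>2 / T\<^sup>2)) \<partial>lborel) = ennreal (?F T - ?F 0)"
  proof (rule nn_integral_FTC_Ioo)
    show "(\<lambda>t. sigma_sq T t + b\<^sup>2 * (t\<^sup>2 / T\<^sup>2)) \<in> borel_measurable borel"
      unfolding sigma_sq_def by measurable
    have "continuous_on {0..T} (\<lambda>t. (?u t)\<^sup>2 * ln (?u t))"
      by (rule continuous_on_compose2[OF continuous_on_square_ln, where f = ?u])
        (use T in \<open>auto intro!: continuous_intros\<close>)
    moreover have "continuous_on {0..T} (\<lambda>t. t\<^sup>2 - t ^ 3 / (3 * T) - T\<^sup>2 * g t + (T - t)\<^sup>2 / 2 + b\<^sup>2 * t ^ 3 / (3 * T\<^sup>2))"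
      if "continuous_on {0..T} g" for g
      using that T by (intro continuous_intros) auto
    ultimately show "continuous_on {0..T} ?F" by blast
    fix t assume t: "t \<in> {0<..<T}"
    then show "0 \<le> sigma_sq T t + b\<^sup>2 * (t\<^sup>2 / T\<^sup>2)"
      using wiener_kernel_square_integral(2)[of t T] by simp
    have pos: "0 < ?u t" using t by simp
    have "((\<lambda>x. x\<^sup>2 * ln x) has_real_derivative 2 * ?u t * ln (?u t) + ?u t) (at (?u t))"
      by (rule derivative_eq_intros refl pos)+ (use pos in \<open>simp add: power2_eq_square\<close>)
    moreover have "(?u has_real_derivative - 1 / T) (at t)"
      using T by (auto intro!: derivative_eq_intros)
    ultimately have "((\<lambda>t. (?u t)\<^sup>2 * ln (?u t)) has_real_derivative
        (2 * ?u t * ln (?u t) + ?u t) * (- 1 / T)) (at t)"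
      by (rule DERIV_chain2)
    moreover have "((\<lambda>t. t\<^sup>2 - t ^ 3 / (3 * T) - T\<^sup>2 * g t + (T - t)\<^sup>2 / 2 + b\<^sup>2 * t ^ 3 / (3 * T\<^sup>2))
        has_real_derivative 2 * t - t\<^sup>2 / T - T\<^sup>2 * g' - (T - t) + b\<^sup>2 * (t\<^sup>2 / T\<^sup>2)) (at t)"
      if "(g has_real_derivative g') (at t)" for g g'
      using T by (auto intro!: derivative_eq_intros that simp: field_simps)
    ultimately have "(?F has_real_derivative 2 * t - t\<^sup>2 / T
      - T\<^sup>2 * ((2 * ?u t * ln (?u t) + ?u t) * (- 1 / T)) - (T - t) + b\<^sup>2 * (t\<^sup>2 / T\<^sup>2)) (at t)"
      by blast
    moreover have "2 * t - t\<^sup>2 / T - T\<^sup>2 * ((2 * ?u t * ln (?u t) + ?u t) * (- 1 / T)) - (T - t) = sigma_sq T t"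
      using T by (simp add: sigma_sq_def field_simps power2_eq_square)
    ultimately show "(?F has_real_derivative sigma_sq T t + b\<^sup>2 * (t\<^sup>2 / T\<^sup>2)) (at t)" by simp
  qed (use T in simp)
  also have "?F T - ?F 0 = T / 3 * (T / 2 + b\<^sup>2)"
    using T by (simp add: field_simps power2_eq_square power3_eq_cube)
  finally show ?thesis .
qed

lemma (in wiener_process) expected_int_sq_dev_eq:
  assumes X: "\<And>t. 0 \<le> t \<Longrightarrow> t < T \<Longrightarrow> has_bochner_integral M (\<lambda>\<omega>. (W t \<omega> - X t \<omega>)\<^sup>2) (v t)"
    and X_measurable: "\<And>t. 0 \<le> t \<Longrightarrow> t < T \<Longrightarrow> X t \<in> borel_measurable M"
    and X_cont: "AE \<omega> in M. continuous_on {0..<T} (\<lambda>t. X t \<omega>)"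
  shows "expected_int_sq_dev M T W X = (\<integral>\<^sup>+t\<in>{0<..<T}. ennreal (v t) \<partial>lborel)"
proof -
  have "AE \<omega> in M. continuous_on {0..<T} (\<lambda>t. W t \<omega> - X t \<omega>)"
    using continuous_paths X_cont
  proof eventually_elim
    case (elim \<omega>)
    have "continuous_on {0..<T} (\<lambda>t. W t \<omega>)"
      by (rule continuous_on_subset[OF elim(1)]) auto
    then show ?case using elim(2) by (intro continuous_on_diff)
  qed
  then have "expected_int_sq_dev M T W X
    = (\<integral>\<^sup>+t\<in>{0<..<T}. (\<integral>\<^sup>+\<omega>. ennreal ((W t \<omega> - X t \<omega>)\<^sup>2) \<partial>M) \<partial>lborel)"
    unfolding expected_int_sq_dev_def
    using random_variable X_measurable
    by (intro nn_integral_swap_AE_continuous sigma_finite_measure_axioms) auto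
  also have "\<dots> = (\<integral>\<^sup>+t\<in>{0<..<T}. ennreal (v t) \<partial>lborel)"
  proof (rule nn_integral_cong)
    fix t :: real
    show "(\<integral>\<^sup>+\<omega>. ennreal ((W t \<omega> - X t \<omega>)\<^sup>2) \<partial>M) * indicator {0<..<T} t = ennreal (v t) * indicator {0<..<T} t"
      using X[of t] by (auto simp: has_bochner_integral_iff nn_integral_eq_integral split: split_indicator)
  qed
  finally show ?thesis .
qed

section \<open>The three bridges\<close>

text \<open>
  The deviation is \<open>t / T * W T - b * (t / T)\<close>, a single increment with a drift.
\<close>

lemma (in wiener_process) bridge_av_deviation:
  assumes "0 < T" "0 \<le> t"
  shows "has_bochner_integral M (\<lambda>\<omega>. (W t \<omega> - bridge_av W T b t \<omega>)\<^sup>2) (t\<^sup>2 / T + b\<^sup>2 * (t\<^sup>2 / T\<^sup>2))"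
proof -
  let ?\<tau> = "\<lambda>i::nat. if i = 0 then 0 else T"
  have "has_bochner_integral M (\<lambda>\<omega>. (step_integral W 1 (\<lambda>_. t / T) ?\<tau> \<omega> - b * (t / T))\<^sup>2)
    ((\<Sum>i<(1::nat). (t / T)\<^sup>2 * (?\<tau> (Suc i) - ?\<tau> i)) + (b * (t / T))\<^sup>2)"
    by (rule step_integral_second_moment) (use assms in \<open>auto simp: mono_on_def\<close>)
  also have "(\<Sum>i<(1::nat). (t / T)\<^sup>2 * (?\<tau> (Suc i) - ?\<tau> i)) + (b * (t / T))\<^sup>2 = t\<^sup>2 / T + b\<^sup>2 * (t\<^sup>2 / T\<^sup>2)"
    using assms by (simp add: power_divide power_mult_distrib power2_eq_square)
  finally have *: "has_bochner_integral M (\<lambda>\<omega>. (step_integral W 1 (\<lambda>_. t / T) ?\<tau> \<omega> - b * (t / T))\<^sup>2)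
    (t\<^sup>2 / T + b\<^sup>2 * (t\<^sup>2 / T\<^sup>2))" .
  have [measurable]: "W t \<in> borel_measurable M" "W T \<in> borel_measurable M"
    using random_variable assms by auto
  show ?thesis
  proof (rule has_bochner_integralI_AE[OF *])
    show "(\<lambda>\<omega>. (W t \<omega> - bridge_av W T b t \<omega>)\<^sup>2) \<in> borel_measurable M"
      unfolding bridge_av_def by measurable
    show "AE \<omega> in M. (step_integral W 1 (\<lambda>_. t / T) ?\<tau> \<omega> - b * (t / T))\<^sup>2 = (W t \<omega> - bridge_av W T b t \<omega>)\<^sup>2"
      using start by eventually_elim (simp add: step_integral_def bridge_av_def algebra_simps)
  qed
qed

text \<open>
  With \<open>u = t * T / (T - t)\<close>, \<open>W t - (T - t) / T * W u\<close> equals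
  \<open>t / T * W t - (T - t) / T * (W u - W t)\<close>, a combination of two successive increments. As
  \<open>u - t = t\<^sup>2 / (T - t)\<close>, the variance is \<open>t\<^sup>3 / T\<^sup>2 + (T - t) * t\<^sup>2 / T\<^sup>2 = t\<^sup>2 / T\<close>.
\<close>

lemma (in wiener_process) bridge_st_deviation:
  assumes "0 \<le> t" "t < T"
  shows "has_bochner_integral M (\<lambda>\<omega>. (W t \<omega> - bridge_st W T b t \<omega>)\<^sup>2) (t\<^sup>2 / T + b\<^sup>2 * (t\<^sup>2 / T\<^sup>2))"
proof -
  let ?u = "t * T / (T - t)"
  let ?\<tau> = "\<lambda>i::nat. if i = 0 then 0 else if i = 1 then t else ?u"
  let ?c = "\<lambda>i::nat. if i = 0 then t / T else - ((T - t) / T)"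
  have u: "?u - t = t\<^sup>2 / (T - t)" using assms by (simp add: field_simps power2_eq_square)
  have "0 \<le> t\<^sup>2 / (T - t)" using assms by simp
  then have tu: "t \<le> ?u" using u by simp
  have "has_bochner_integral M (\<lambda>\<omega>. (step_integral W 2 ?c ?\<tau> \<omega> - b * (t / T))\<^sup>2)
    ((\<Sum>i<(2::nat). (?c i)\<^sup>2 * (?\<tau> (Suc i) - ?\<tau> i)) + (b * (t / T))\<^sup>2)"
    by (rule step_integral_second_moment) (use assms tu in \<open>auto simp: mono_on_def\<close>)
  also have "(\<Sum>i<(2::nat). (?c i)\<^sup>2 * (?\<tau> (Suc i) - ?\<tau> i)) + (b * (t / T))\<^sup>2
    = t\<^sup>2 / T + b\<^sup>2 * (t\<^sup>2 / T\<^sup>2)"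
  proof -
    have "(t / T)\<^sup>2 * t + ((T - t) / T)\<^sup>2 * (t\<^sup>2 / (T - t)) = t\<^sup>2 / T"
      using assms by (simp add: divide_simps) (simp add: power2_eq_square algebra_simps)
    then show ?thesis by (simp add: numeral_2_eq_2 u power_mult_distrib power_divide)
  qed
  finally have *: "has_bochner_integral M (\<lambda>\<omega>. (step_integral W 2 ?c ?\<tau> \<omega> - b * (t / T))\<^sup>2)
    (t\<^sup>2 / T + b\<^sup>2 * (t\<^sup>2 / T\<^sup>2))" .
  have [measurable]: "W t \<in> borel_measurable M" "W ?u \<in> borel_measurable M"
    using random_variable assms tu by auto
  show ?thesis
  proof (rule has_bochner_integralI_AE[OF *])
    show "(\<lambda>\<omega>. (W t \<omega> - bridge_st W T b t \<omega>)\<^sup>2) \<in> borel_measurable M"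
      unfolding bridge_st_def using assms by simp
    have combine: "t / T * w - (T - t) / T * (w' - w) - a = w - (a + (T - t) / T * w')" for w w' a :: real
      using assms by (simp add: field_simps)
    show "AE \<omega> in M. (step_integral W 2 ?c ?\<tau> \<omega> - b * (t / T))\<^sup>2 = (W t \<omega> - bridge_st W T b t \<omega>)\<^sup>2"
      using start
    proof eventually_elim
      case (elim \<omega>)
      have "step_integral W 2 ?c ?\<tau> \<omega> = t / T * W t \<omega> - (T - t) / T * (W ?u \<omega> - W t \<omega>)"
        using elim by (simp add: step_integral_def numeral_2_eq_2)
      then show ?case using assms by (simp only: combine bridge_st_def if_True)
    qed
  qed
qed

lemma (in wiener_process) bridge_ir_deviation:
  assumes "0 \<le> t" "t < T" "has_wiener_integral M W t (\<lambda>s. (T - t) / (T - s)) (J t)"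
  shows "has_bochner_integral M (\<lambda>\<omega>. (W t \<omega> - bridge_ir J T b t \<omega>)\<^sup>2) (sigma_sq T t + b\<^sup>2 * (t\<^sup>2 / T\<^sup>2))"
proof (rule has_bochner_integral_nn_integral)
  note sigma = wiener_kernel_square_integral[OF assms(1,2)]
  have [measurable]: "W t \<in> borel_measurable M" "J t \<in> borel_measurable M"
    using random_variable assms by (auto simp: has_wiener_integral_def)
  show "(\<lambda>\<omega>. (W t \<omega> - bridge_ir J T b t \<omega>)\<^sup>2) \<in> borel_measurable M"
    unfolding bridge_ir_def by measurable
  show "0 \<le> sigma_sq T t + b\<^sup>2 * (t\<^sup>2 / T\<^sup>2)" using sigma by simp
  have "(\<integral>\<^sup>+\<omega>. ennreal ((W t \<omega> - bridge_ir J T b t \<omega>)\<^sup>2) \<partial>M)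
    = (\<integral>\<^sup>+\<omega>. ennreal ((W t \<omega> - J t \<omega> - b * (t / T))\<^sup>2) \<partial>M)"
    using assms by (simp add: bridge_ir_def algebra_simps)
  also have "\<dots> = ennreal (sigma_sq T t) + ennreal ((b * (t / T))\<^sup>2)"
    using wiener_integral_deviation[OF assms(1,3)] sigma(1) by simp
  also have "\<dots> = ennreal (sigma_sq T t + b\<^sup>2 * (t\<^sup>2 / T\<^sup>2))"
    using sigma(2) by (simp add: power_mult_distrib power_divide)
  finally show "(\<integral>\<^sup>+\<omega>. ennreal ((W t \<omega> - bridge_ir J T b t \<omega>)\<^sup>2) \<partial>M)
    = ennreal (sigma_sq T t + b\<^sup>2 * (t\<^sup>2 / T\<^sup>2))" .
qed simp

lemma (in wiener_process) bridge_av_measurable_continuous: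
  assumes "0 < T"
  shows "0 \<le> t \<Longrightarrow> bridge_av W T b t \<in> borel_measurable M"
    and "AE \<omega> in M. continuous_on {0..<T} (\<lambda>t. bridge_av W T b t \<omega>)"
proof -
  show "bridge_av W T b t \<in> borel_measurable M" if "0 \<le> t"
  proof -
    have [measurable]: "W t \<in> borel_measurable M" "W T \<in> borel_measurable M"
      using random_variable assms that by auto
    show ?thesis unfolding bridge_av_def[abs_def] by measurable
  qed
  show "AE \<omega> in M. continuous_on {0..<T} (\<lambda>t. bridge_av W T b t \<omega>)"
    using continuous_paths
  proof eventually_elim
    case (elim \<omega>)
    have "continuous_on {0..<T} (\<lambda>t. W t \<omega>)"
      by (rule continuous_on_subset[OF elim]) auto
    then show ?case unfolding bridge_av_def using assms by (intro continuous_intros) auto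
  qed
qed

lemma (in wiener_process) bridge_st_measurable_continuous:
  shows "0 \<le> t \<Longrightarrow> t < T \<Longrightarrow> bridge_st W T b t \<in> borel_measurable M"
    and "AE \<omega> in M. continuous_on {0..<T} (\<lambda>t. bridge_st W T b t \<omega>)"
proof -
  show "bridge_st W T b t \<in> borel_measurable M" if "0 \<le> t" "t < T"
  proof -
    have [measurable]: "W (t * T / (T - t)) \<in> borel_measurable M"
      using random_variable that by auto
    show ?thesis unfolding bridge_st_def[abs_def] using that by simp
  qed
  show "AE \<omega> in M. continuous_on {0..<T} (\<lambda>t. bridge_st W T b t \<omega>)"
    using continuous_paths
  proof eventually_elim
    case (elim \<omega>)
    have "continuous_on {0..<T} (\<lambda>t. W (t * T / (T - t)) \<omega>)"
      by (rule continuous_on_compose2[OF elim]) (auto intro!: continuous_intros)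
    then have "continuous_on {0..<T} (\<lambda>t. b * (t / T) + ((T - t) / T) * W (t * T / (T - t)) \<omega>)"
      by (intro continuous_intros) auto
    then show ?case by (subst continuous_on_cong[OF refl]) (auto simp: bridge_st_def)
  qed
qed

lemma bridge_ir_measurable_continuous:
  assumes "bridge_integral M W T J"
  shows "0 \<le> t \<Longrightarrow> t < T \<Longrightarrow> bridge_ir J T b t \<in> borel_measurable M"
    and "AE \<omega> in M. continuous_on {0..<T} (\<lambda>t. bridge_ir J T b t \<omega>)"
proof -
  show "bridge_ir J T b t \<in> borel_measurable M" if "0 \<le> t" "t < T"
  proof -
    have [measurable]: "J t \<in> borel_measurable M"
      using assms that by (auto simp: bridge_integral_def has_wiener_integral_def)
    show ?thesis unfolding bridge_ir_def[abs_def] using that by simp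
  qed
  from assms have "AE \<omega> in M. continuous_on {0..<T} (\<lambda>t. J t \<omega>)"
    by (simp add: bridge_integral_def)
  then show "AE \<omega> in M. continuous_on {0..<T} (\<lambda>t. bridge_ir J T b t \<omega>)"
  proof eventually_elim
    case (elim \<omega>)
    then have "continuous_on {0..<T} (\<lambda>t. b * (t / T) + J t \<omega>)"
      by (intro continuous_intros) auto
    then show ?case by (subst continuous_on_cong[OF refl]) (auto simp: bridge_ir_def)
  qed
qed

theorem theorem2p6:
  fixes M :: "'a measure" and W J :: "real \<Rightarrow> 'a \<Rightarrow> real" and T b :: real
  assumes "wiener_process M W"
    and "T > 0"
    and "bridge_integral M W T J"
  shows "(\<forall>t. 0 \<le> t \<and> t < T \<longrightarrow>
            has_bochner_integral M (\<lambda>\<omega>. (W t \<omega> - bridge_av W T b t \<omega>)\<^sup>2) (t\<^sup>2 / T + b\<^sup>2 * (t\<^sup>2 / T\<^sup>2)) \<and>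
            has_bochner_integral M (\<lambda>\<omega>. (W t \<omega> - bridge_st W T b t \<omega>)\<^sup>2) (t\<^sup>2 / T + b\<^sup>2 * (t\<^sup>2 / T\<^sup>2)) \<and>
            has_bochner_integral M (\<lambda>\<omega>. (W t \<omega> - bridge_ir J T b t \<omega>)\<^sup>2) (sigma_sq T t + b\<^sup>2 * (t\<^sup>2 / T\<^sup>2))) \<and>
         expected_int_sq_dev M T W (bridge_av W T b) = ennreal (T / 3 * (T + b\<^sup>2)) \<and>
         expected_int_sq_dev M T W (bridge_st W T b) = ennreal (T / 3 * (T + b\<^sup>2)) \<and>
         expected_int_sq_dev M T W (bridge_ir J T b) = ennreal (T / 3 * (T / 2 + b\<^sup>2))"
proof -
  interpret wiener_process M W by fact
  have ir: "has_bochner_integral M (\<lambda>\<omega>. (W t \<omega> - bridge_ir J T b t \<omega>)\<^sup>2) (sigma_sq T t + b\<^sup>2 * (t\<^sup>2 / T\<^sup>2))"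
    if "0 \<le> t" "t < T" for t
    using bridge_ir_deviation that assms(3) by (simp add: bridge_integral_def)
  have "(\<integral>\<^sup>+t\<in>{0<..<T}. ennreal (t\<^sup>2 / T + b\<^sup>2 * (t\<^sup>2 / T\<^sup>2)) \<partial>lborel)
    = (\<integral>\<^sup>+t\<in>{0<..<T}. ennreal ((1 / T + b\<^sup>2 / T\<^sup>2) * t\<^sup>2) \<partial>lborel)"
    by (simp add: algebra_simps)
  also have "\<dots> = ennreal ((1 / T + b\<^sup>2 / T\<^sup>2) * T ^ 3 / 3)"
    using \<open>T > 0\<close> by (intro nn_integral_scaled_square) auto
  also have "(1 / T + b\<^sup>2 / T\<^sup>2) * T ^ 3 / 3 = T / 3 * (T + b\<^sup>2)"
    using \<open>T > 0\<close> by (simp add: field_simps power2_eq_square power3_eq_cube)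
  finally have quadratic: "(\<integral>\<^sup>+t\<in>{0<..<T}. ennreal (t\<^sup>2 / T + b\<^sup>2 * (t\<^sup>2 / T\<^sup>2)) \<partial>lborel)
    = ennreal (T / 3 * (T + b\<^sup>2))" .
  have "expected_int_sq_dev M T W (bridge_av W T b) = ennreal (T / 3 * (T + b\<^sup>2))"
    unfolding quadratic[symmetric]
    by (intro expected_int_sq_dev_eq bridge_av_deviation bridge_av_measurable_continuous \<open>T > 0\<close>)
  moreover have "expected_int_sq_dev M T W (bridge_st W T b) = ennreal (T / 3 * (T + b\<^sup>2))"
    unfolding quadratic[symmetric]
    by (intro expected_int_sq_dev_eq bridge_st_deviation bridge_st_measurable_continuous)
  moreover have "expected_int_sq_dev M T W (bridge_ir J T b) = ennreal (T / 3 * (T / 2 + b\<^sup>2))"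
    unfolding nn_integral_sigma_sq[OF \<open>T > 0\<close>, symmetric]
    by (intro expected_int_sq_dev_eq ir bridge_ir_measurable_continuous[OF assms(3)])
  ultimately show ?thesis
    using bridge_av_deviation[OF \<open>T > 0\<close>] bridge_st_deviation ir by blast
qed

end
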